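(* Consider the four-point vortex system with strengths $\Gamma_1=\Gamma_2=\Gamma_3=1$ and $\Gamma_4=-1$. For each of the two choices of sign (upper signs throughout, or lower signs throughout) let $$a=\mp\frac13\left(\sqrt5-\sqrt2\right),\qquad b=\frac12\pm\frac16\left(\sqrt5-\sqrt2\right),\qquad c=\sqrt{\frac16\left(\sqrt{10}-2\mp\left(\sqrt5-\sqrt2\right)\right)}.$$ Then the configuration $$k_1=a,\qquad k_2=b+ic,\qquad k_3=b-ic,\qquad k_4=1$$ is in relative equilibrium.
   Context: The $N$-point vortex system with strengths $\Gamma_m\in\mathbb{R}$ and initial positions $k_m\in\mathbb{C}$ is $$\frac{dz_m}{dt} = \frac{-1}{2\pi i}\sum_{n\neq m}\frac{\Gamma_n}{\overline{z}_m-\overline{z}_n},\qquad z_m(0)=k_m,\qquad m=1,\dots,N,$$ where $z_m(t)\in\mathbb{C}$ and the bar denotes complex conjugation. A configuration $(k_1,\dots,k_N)$ of pairwise distinct points is in relative equilibrium if it rotates rigidly about the origin: there is a real constant $B\neq 0$ such that $z_m(t)=k_m e^{iBt}$, $m=1,\dots,N$, solves the system. Equivalently, there is a real $B\ne0$, independent of $m$, with $$iB\,k_m=\frac{i}{2\pi}\sum_{n\neq m}\frac{\Gamma_n}{\overline{k}_m-\overline{k}_n}\qquad(m=1,\dots,N).$$ *)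

theory Defs
  imports "HOL-Analysis.Analysis"
begin

text \<open>Vortices are indexed by \<open>{1..N}\<close>; the values of \<open>\<Gamma>\<close>, \<open>k\<close> and \<open>z\<close> at other indices are
  never used.\<close>

definition vortex_velocity :: "nat \<Rightarrow> (nat \<Rightarrow> real) \<Rightarrow> (nat \<Rightarrow> complex) \<Rightarrow> nat \<Rightarrow> complex" where
  "vortex_velocity N \<Gamma> w m =
     - 1 / (2 * complex_of_real pi * \<i>) *
       (\<Sum>n\<in>{1..N} - {m}. complex_of_real (\<Gamma> n) / (cnj (w m) - cnj (w n)))"

text \<open>Solutions are taken on the whole time axis. The injectivity clause keeps the vortices apart at
  all times: the system is singular at collisions, where HOL would read \<open>x / 0\<close> as \<open>0\<close>.\<close>

definition vortex_solution ::
    "nat \<Rightarrow> (nat \<Rightarrow> real) \<Rightarrow> (nat \<Rightarrow> complex) \<Rightarrow> (nat \<Rightarrow> real \<Rightarrow> complex) \<Rightarrow> bool" where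
  "vortex_solution N \<Gamma> k z \<longleftrightarrow>
     (\<forall>t. inj_on (\<lambda>m. z m t) {1..N}) \<and>
     (\<forall>m\<in>{1..N}. z m 0 = k m \<and>
        (\<forall>t. (z m has_vector_derivative vortex_velocity N \<Gamma> (\<lambda>n. z n t) m) (at t)))"

definition relative_equilibrium :: "nat \<Rightarrow> (nat \<Rightarrow> real) \<Rightarrow> (nat \<Rightarrow> complex) \<Rightarrow> bool" where
  "relative_equilibrium N \<Gamma> k \<longleftrightarrow>
     inj_on k {1..N} \<and>
     (\<exists>B::real. B \<noteq> 0 \<and>
        vortex_solution N \<Gamma> k (\<lambda>m t. k m * exp (\<i> * complex_of_real B * complex_of_real t)))"

end

(* The system commutes with rotations, so it suffices to find a real l \<noteq> 0 with
   l * k m = (\<Sum>n\<noteq>m. \<Gamma> n / cnj (k m - k n)) for all m. Both sign choices make a a root of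
   9 x^4 - 14 x^2 + 1 in (-1/3, 1/3), and b = (1 - a) / 2, c^2 = (1 - a) (1 + 3 a) / 4. Hence the
   squared distances between the vortices lie in the field generated by a, and modulo this quartic
   the four equations become polynomial identities. *)

theory Submission
  imports Defs
begin

text \<open>A unimodular \<open>u\<close> satisfies \<open>cnj u = 1 / u\<close>, so a factor
  \<open>cnj u\<close> in each denominator becomes a factor \<open>u\<close> in front.\<close>

lemma vortex_velocity_rotate:
  assumes "cmod u = 1"
  shows "vortex_velocity N \<Gamma> (\<lambda>n. w n * u) m = u * vortex_velocity N \<Gamma> w m"
proof -
  have "u * cnj u = 1"
    using assms by (simp add: complex_norm_square [symmetric])
  then have "cnj u = 1 / u"
    by (metis mult_zero_left nonzero_eq_divide_eq mult.commute zero_neq_one)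
  then have "x / (cnj (w m * u) - cnj (w n * u)) = u * (x / (cnj (w m) - cnj (w n)))" for x n
    by (simp add: diff_divide_distrib [symmetric] mult.commute)
  then show ?thesis
    unfolding vortex_velocity_def
    by (simp add: sum_distrib_left mult.left_commute)
qed

text \<open>By rotation equivariance the differential equation at every time reduces to the
  algebraic condition at time 0.\<close>

lemma relative_equilibriumI:
  fixes B :: real
  assumes inj: "inj_on k {1..N}" and "B \<noteq> 0"
    and vel: "\<And>m. m \<in> {1..N} \<Longrightarrow> vortex_velocity N \<Gamma> k m = \<i> * of_real B * k m"
  shows "relative_equilibrium N \<Gamma> k"
proof -
  let ?u = "\<lambda>t::real. exp (\<i> * complex_of_real B * complex_of_real t)"
  have norm_u: "cmod (?u t) = 1" for t
    by simp
  have deriv: "(?u has_vector_derivative \<i> * of_real B * ?u t) (at t)" for t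
    by (rule has_vector_derivative_real_field) (auto intro!: derivative_eq_intros)
  have "((\<lambda>t. k m * ?u t) has_vector_derivative
           vortex_velocity N \<Gamma> (\<lambda>n. k n * ?u t) m) (at t)" if "m \<in> {1..N}" for m t
    using has_vector_derivative_mult_right [OF deriv [of t], of "k m"]
    unfolding vortex_velocity_rotate [OF norm_u] vel [OF that] by (simp only: mult_ac)
  moreover have "inj_on (\<lambda>m. k m * ?u t) {1..N}" for t
    by (rule inj_onI) (simp add: inj_on_eq_iff [OF inj])
  ultimately show ?thesis
    using inj \<open>B \<noteq> 0\<close> unfolding relative_equilibrium_def vortex_solution_def by auto
qed

text \<open>Since 1 / cnj v = v / |v|^2, a known inverse \<open>q\<close> of the squared distance
  removes the division and the conjugates.\<close>

lemma divide_cnj_eq: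
  assumes "q * (cmod (z - w))\<^sup>2 = 1"
  shows "x / (cnj z - cnj w) = x * of_real q * (z - w)"
proof -
  have "of_real q * ((z - w) * cnj (z - w)) = 1"
    using assms by (metis complex_norm_square of_real_1 of_real_mult)
  then show ?thesis
    by (simp add: divide_eq_eq mult_ac)
qed

theorem proposition4p1:
  fixes \<Gamma> :: "nat \<Rightarrow> real" and k :: "nat \<Rightarrow> complex" and \<sigma> a b c :: real
  assumes "\<Gamma> 1 = 1" and "\<Gamma> 2 = 1" and "\<Gamma> 3 = 1" and "\<Gamma> 4 = - 1"
    and "\<sigma> = 1 \<or> \<sigma> = - 1"
    and "a = - \<sigma> * (1 / 3) * (sqrt 5 - sqrt 2)"
    and "b = 1 / 2 + \<sigma> * (1 / 6) * (sqrt 5 - sqrt 2)"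
    and "c = sqrt (1 / 6 * (sqrt 10 - 2 - \<sigma> * (sqrt 5 - sqrt 2)))"
    and "k 1 = complex_of_real a"
    and "k 2 = complex_of_real b + \<i> * complex_of_real c"
    and "k 3 = complex_of_real b - \<i> * complex_of_real c"
    and "k 4 = 1"
  shows "relative_equilibrium 4 \<Gamma> k"
proof -
  let ?d = "sqrt 5 - sqrt 2"
  note [simp] = assms(1-4) and [simp del] = One_nat_def
  note k = assms(9-12)
  have \<sigma>: "\<sigma>\<^sup>2 = 1"
    using assms(5) by auto
  have d: "?d\<^sup>2 = 7 - 2 * sqrt 10"
    by (simp add: power2_diff real_sqrt_mult [symmetric])
  have a2: "9 * a\<^sup>2 = 7 - 2 * sqrt 10"
    using \<sigma> d by (simp add: assms(6) power_mult_distrib power_divide)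
  have s10: "(sqrt 10)\<^sup>2 = 10"
    by simp
  \<comment> \<open>Eliminate the root: (7 - 9 a^2)^2 = 40.\<close>
  have quartic: "9 * a ^ 4 - 14 * a\<^sup>2 + 1 = 0"
    using a2 s10 by algebra
  have "3 < sqrt 10"
    by (rule real_less_rsqrt) simp
  then have "a\<^sup>2 < (1 / 3)\<^sup>2"
    using a2 by (simp add: power2_eq_square)
  then have "\<bar>a\<bar> < 1 / 3"
    using abs_less_iff abs_le_square_iff [of "1/3" a] by auto
  then have a: "- 1 / 3 < a" "a < 1 / 3"
    by auto
  \<comment> \<open>Equivalently a + 2 b - 1 = 0: the centre of vorticity is the origin.\<close>
  have b: "b = (1 - a) / 2"
    by (simp add: assms(6,7))
  have "\<sigma> * ?d = - 3 * a"
    by (simp add: assms(6))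
  then have "1 / 6 * (sqrt 10 - 2 - \<sigma> * ?d) = 1 / 6 * (sqrt 10 - 2 + 3 * a)"
    by simp
  also have "\<dots> = (1 - a) * (1 + 3 * a) / 4"
    using a2 by (simp add: field_simps power2_eq_square)
  finally have "1 / 6 * (sqrt 10 - 2 - \<sigma> * ?d) = (1 - a) * (1 + 3 * a) / 4" .
  moreover have "0 < (1 - a) * (1 + 3 * a) / 4"
    using a by simp
  ultimately have c2: "c\<^sup>2 = (1 - a) * (1 + 3 * a) / 4" and c: "c > 0"
    by (simp_all add: assms(8))

  (* p, q, r are the inverses of |k1 - k2|^2, |k2 - k4|^2, |k2 - k3|^2, and s that of |k1 - k4|, reduced
     modulo the quartic. *)
  define p where "p = (17 + 28 * a - 9 * a\<^sup>2 - 18 * a ^ 3) / 8"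
  define q where "q = (28 - 61 * a - 18 * a\<^sup>2 + 45 * a ^ 3) / 8"
  define r where "r = (11 - 28 * a - 9 * a\<^sup>2 + 18 * a ^ 3) / 4"
  define s where "s = (5 + 5 * a - 9 * a\<^sup>2 - 9 * a ^ 3) / 4"
  \<comment> \<open>This value is forced by the equation for vortex 4, where \<open>k 4 = 1\<close>
    and 2 (1 - b) = 1 + a.\<close>
  define l where "l = s + (1 + a) * q"
  have inverses: "p * ((a - b)\<^sup>2 + c\<^sup>2) = 1" "q * ((1 - b)\<^sup>2 + c\<^sup>2) = 1"
      "r * (2 * c)\<^sup>2 = 1" "s * (1 - a) = 1"
    using c2 b quartic p_def q_def r_def s_def by algebra+
  have "0 < q" "0 < s"
    using inverses(2,4) a c zero_less_mult_iff [of q "(1 - b)\<^sup>2 + c\<^sup>2"]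
      zero_less_mult_iff [of s "1 - a"] sum_power2_ge_zero [of "1 - b" c]
    by linarith+
  then have "l > 0"
    using a by (simp add: l_def add_pos_pos)

  \<comment> \<open>Here \<open>s\<close> inverts a distance, so \<open>divide_cnj_eq\<close> needs
    its square; the first identity then turns the result back into \<open>s\<close>.\<close>
  have s2: "s\<^sup>2 * (1 - a) = s" "s\<^sup>2 * (1 - a)\<^sup>2 = 1"
    using inverses(4) by algebra+
  have dist: "p * (cmod (k 1 - k 2))\<^sup>2 = 1" "p * (cmod (k 2 - k 1))\<^sup>2 = 1"
      "p * (cmod (k 1 - k 3))\<^sup>2 = 1" "p * (cmod (k 3 - k 1))\<^sup>2 = 1"
      "q * (cmod (k 4 - k 2))\<^sup>2 = 1" "q * (cmod (k 2 - k 4))\<^sup>2 = 1"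
      "q * (cmod (k 4 - k 3))\<^sup>2 = 1" "q * (cmod (k 3 - k 4))\<^sup>2 = 1"
      "r * (cmod (k 2 - k 3))\<^sup>2 = 1" "r * (cmod (k 3 - k 2))\<^sup>2 = 1"
      "s\<^sup>2 * (cmod (k 1 - k 4))\<^sup>2 = 1" "s\<^sup>2 * (cmod (k 4 - k 1))\<^sup>2 = 1"
    using inverses s2(2)
    by (simp_all add: k cmod_power2 power2_commute [of b] power2_commute [of a 1])
  \<comment> \<open>The equation for vortex 1; the imaginary contributions of vortices 2 and 3
    cancel.\<close>
  have on_axis: "2 * p * (a - b) + s = l * a"
    using b quartic p_def q_def s_def l_def by algebra
  \<comment> \<open>Real part, and imaginary part divided by \<open>c\<close>, of the equation for
    vortex 2; vortex 3 gives the conjugate equation.\<close>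
  have off_axis: "p * (b - a) - q * (b - 1) = l * b" "p + 2 * r - q = l"
    using b quartic p_def q_def r_def s_def l_def by algebra+
  have indices: "{1..4} = {1, 2, 3, 4::nat}"
    by auto
  let ?S = "\<lambda>m. \<Sum>n\<in>{1..4} - {m}. of_real (\<Gamma> n) / (cnj (k m) - cnj (k n))"
  have "?S 1 = of_real l * k 1" "?S 2 = of_real l * k 2"
      "?S 3 = of_real l * k 3" "?S 4 = of_real l * k 4"
    by (simp add: indices insert_Diff_if dist [THEN divide_cnj_eq]; rule complex_eqI;
        simp add: k flip: of_real_power; use on_axis off_axis s2(1) l_def b in algebra)+
  then have "?S m = of_real l * k m" if "m \<in> {1..4}" for m
    using that unfolding indices by blast
  \<comment> \<open>The prefactor -1 / (2 pi i) equals i / (2 pi), hence the angular velocity l / (2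
    pi).\<close>
  then have "vortex_velocity 4 \<Gamma> k m = \<i> * of_real (l / (2 * pi)) * k m" if "m \<in> {1..4}" for m
    using that unfolding vortex_velocity_def by (simp add: field_simps)
  moreover have "inj_on k {1..4}"
    using a c by (simp add: indices k b complex_eq_iff)
  ultimately show ?thesis
    using \<open>l > 0\<close> by (intro relative_equilibriumI [where B = "l / (2 * pi)"]) auto
qed

end
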